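(* Let $n\ge2$, $A\in\mathbb{R}_+^{n\times n}$, $p\in\mathbb{R}_+^n$ and $\gamma\in\mathbb{R}$. Define $E\colon(\mathbb{R}_+\setminus\{0\})^n\to\mathbb{R}_+$ by $$E(\eta)=\prod_{i=1}^n\frac1{\eta_i}\Bigl(p_i+\sum_{j=1}^nA_{i,j}\eta_j\Bigr),$$ define $g\colon\mathbb{R}^n\to\mathbb{R}_+$ by $g(x)=E(\exp(x))$, and for $s\in\mathbb{R}$ let $V_s=\{v\in\mathbb{R}^n\mid v_1+\dots+v_n=s\}$. Then $g$ is convex. Moreover, if all diagonal entries of $A$ are positive and $A$ or $\left(\begin{smallmatrix}A&p\\ \mathbf{1}&1\end{smallmatrix}\right)$ is irreducible, then the following hold. (i) $g$ is strictly convex on $V_\gamma$. More precisely, $g''(x)h^2>0$ for all $x\in V_\gamma$ and $h\in V_0\setminus\{0\}$. (ii) Let $\mu$ be the smallest nonzero entry of $A$ and $p$, and let $c=(n-1)^{-1}$. Then $x\in V_\gamma$ implies $$g(x)\ge\mu^n\exp(-|\gamma|c)\exp(c\|x\|_\infty).$$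
   Context: $\mathbb{R}_+$ is the set of nonnegative reals. $\exp$ of a vector is taken component-wise. $\mathbf{1}$ denotes the all-ones vector $(1,\dots,1)$ (here a row of length $n$, so that $\left(\begin{smallmatrix}A&p\\ \mathbf{1}&1\end{smallmatrix}\right)$ is an $(n+1)\times(n+1)$ matrix). $g''(x)h^2$ denotes the second derivative of $g$ at $x$ evaluated at $(h,h)$. A matrix $M\in\mathbb{R}^{k\times k}$ is irreducible if for any $r,s\in\{1,\dots,k\}$ with $r\ne s$ there exist distinct indices $i_1,\dots,i_m\in\{1,\dots,k\}$ with $i_1=r$, $i_m=s$ and $M_{i_l,i_{l+1}}>0$ for all $l\in\{1,\dots,m-1\}$. *)

theory Defs
  imports "HOL-Analysis.Analysis"
begin

definition vec_exp :: "real ^ 'n \<Rightarrow> real ^ 'n" where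
  "vec_exp x = (\<chi> i. exp (x $ i))"

definition E :: "real ^ 'n ^ 'n \<Rightarrow> real ^ 'n \<Rightarrow> real ^ 'n \<Rightarrow> real" where
  "E A p \<eta> = (\<Prod>i\<in>UNIV. 1 / \<eta> $ i * (p $ i + (\<Sum>j\<in>UNIV. A $ i $ j * \<eta> $ j)))"

definition g :: "real ^ 'n ^ 'n \<Rightarrow> real ^ 'n \<Rightarrow> real ^ 'n \<Rightarrow> real" where
  "g A p x = E A p (vec_exp x)"

definition V :: "real \<Rightarrow> (real ^ 'n) set" where
  "V s = {v. (\<Sum>i\<in>UNIV. v $ i) = s}"

(* The block matrix with rows (A p) and (1 1); the index None is the additional last row and column. *)
definition bordered :: "real ^ 'n ^ 'n \<Rightarrow> real ^ 'n \<Rightarrow> real ^ 'n option ^ 'n option" where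
  "bordered A p =
     (\<chi> r s. case r of None \<Rightarrow> 1 | Some i \<Rightarrow> (case s of None \<Rightarrow> p $ i | Some j \<Rightarrow> A $ i $ j))"

definition irreducible_matrix :: "real ^ 'k ^ 'k \<Rightarrow> bool" where
  "irreducible_matrix M \<longleftrightarrow>
     (\<forall>r s. r \<noteq> s \<longrightarrow>
       (\<exists>is. is \<noteq> [] \<and> distinct is \<and> hd is = r \<and> last is = s \<and>
          (\<forall>l. Suc l < length is \<longrightarrow> M $ (is ! l) $ (is ! Suc l) > 0)))"

definition strictly_convex_on :: "'a::real_vector set \<Rightarrow> ('a \<Rightarrow> real) \<Rightarrow> bool" where
  "strictly_convex_on S f \<longleftrightarrow> convex S \<and>
     (\<forall>x\<in>S. \<forall>y\<in>S. \<forall>t. x \<noteq> y \<and> 0 < t \<and> t < 1 \<longrightarrow>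
        f ((1 - t) *\<^sub>R x + t *\<^sub>R y) < (1 - t) * f x + t * f y)"

(* f is Frechet differentiable near x and its derivative, as a map into the bounded linear maps,
   is Frechet differentiable at x with derivative D.  Such D is unique, and D h k is the second
   derivative of f at x evaluated at (h,k). *)
definition has_second_derivative ::
  "('a::real_normed_vector \<Rightarrow> real) \<Rightarrow> ('a \<Rightarrow>\<^sub>L 'a \<Rightarrow>\<^sub>L real) \<Rightarrow> 'a \<Rightarrow> bool" where
  "has_second_derivative f D x \<longleftrightarrow>
     (\<exists>f' :: 'a \<Rightarrow> 'a \<Rightarrow>\<^sub>L real.
        (\<forall>\<^sub>F y in nhds x. (f has_derivative blinfun_apply (f' y)) (at y)) \<and>
        (f' has_derivative blinfun_apply D) (at x))"

definition smallest_nonzero_entry :: "real ^ 'n ^ 'n \<Rightarrow> real ^ 'n \<Rightarrow> real" where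
  "smallest_nonzero_entry A p = Min ((range (\<lambda>(i, j). A $ i $ j) \<union> range (\<lambda>i. p $ i)) - {0})"

end

theory Submission
  imports Defs
begin

text \<open>
  Expanding the product over \<open>i\<close> writes \<open>g\<close> as a sum over all maps
  \<open>f : {1..n} \<rightarrow> {1..n} \<union> {None}\<close> of nonnegative multiples of the exponentials of the linear
  functionals \<open>x \<mapsto> \<Sum>i. x_(f i) - x_i\<close>, where \<open>x_None = 0\<close>; this gives convexity and an explicit
  second derivative. If \<open>f\<close> follows a simple path from \<open>r\<close> to \<open>s\<close> and fixes every other index,
  then its functional telescopes to \<open>x_s - x_r\<close>, and its coefficient is positive because the diagonal
  of \<open>A\<close> is. Irreducibility of \<open>A\<close> supplies such an \<open>f\<close> for all \<open>r\<close> and \<open>s\<close>, irreducibility of the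
  bordered matrix for all \<open>r\<close> and \<open>s = None\<close>. Either family of functionals separates the points
  of \<open>V 0\<close>, and a single summand already gives the lower bound.
\<close>

subsection \<open>Sums of exponentials\<close>

text \<open>The tangent of \<open>exp\<close> at the convex combination \<open>m\<close> lies
  strictly below \<open>exp\<close> off \<open>m\<close>. Averaging its values at \<open>a\<close>
  and \<open>b\<close> gives back its value at \<open>m\<close>, which is
  \<open>exp m\<close>.\<close>

lemma exp_strictly_convex:
  fixes a b t :: real
  assumes "a \<noteq> b" "0 < t" "t < 1"
  shows "exp ((1 - t) * a + t * b) < (1 - t) * exp a + t * exp b"
proof -
  define m where "m = (1 - t) * a + t * b"
  have tangent: "exp m * (1 + (z - m)) < exp z" if "z \<noteq> m" for z
  proof -
    have "1 + (z - m) < exp (z - m)"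
      using that exp_ge_add_one_self[of "z - m"] ln_eq_minus_one[of "exp (z - m)"]
      by (auto simp: order.strict_iff_order)
    then have "exp m * (1 + (z - m)) < exp m * exp (z - m)" by simp
    then show ?thesis by (simp add: exp_diff)
  qed
  have "a - m = t * (a - b)" "b - m = (1 - t) * (b - a)"
    by (simp_all add: m_def algebra_simps)
  then have "a \<noteq> m" "b \<noteq> m"
    using assms by auto
  then have "(1 - t) * (exp m * (1 + (a - m))) < (1 - t) * exp a"
    and "t * (exp m * (1 + (b - m))) < t * exp b"
    using assms tangent by simp_all
  moreover have "(1 - t) * (exp m * (1 + (a - m))) + t * (exp m * (1 + (b - m)))
      = exp m * (1 + ((1 - t) * a + t * b - m))"
    by (simp add: algebra_simps)
  ultimately show ?thesis
    by (simp add: m_def)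
qed

lemma exp_inner_convex_le:
  fixes u x y :: "'a::real_inner"
  assumes "0 < t" "t < 1"
  shows "exp (u \<bullet> ((1 - t) *\<^sub>R x + t *\<^sub>R y)) \<le> (1 - t) * exp (u \<bullet> x) + t * exp (u \<bullet> y)"
  using exp_strictly_convex[of "u \<bullet> x" "u \<bullet> y" t] assms
  by (cases "u \<bullet> x = u \<bullet> y") (auto simp: inner_add_right algebra_simps)

definition exp_sum :: "'i set \<Rightarrow> ('i \<Rightarrow> real) \<Rightarrow> ('i \<Rightarrow> 'a::real_inner) \<Rightarrow> 'a \<Rightarrow> real" where
  "exp_sum F c u x = (\<Sum>f\<in>F. c f * exp (u f \<bullet> x))"

lemma convex_combination_exp_sum:
  "(1 - t) * exp_sum F c u x + t * exp_sum F c u y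
    = (\<Sum>f\<in>F. c f * ((1 - t) * exp (u f \<bullet> x) + t * exp (u f \<bullet> y)))"
  by (simp add: exp_sum_def sum_distrib_left sum.distrib[symmetric] algebra_simps)

lemma convex_on_exp_sum:
  assumes "\<And>f. f \<in> F \<Longrightarrow> 0 \<le> c f"
  shows "convex_on UNIV (exp_sum F c u)"
proof (rule convex_onI)
  fix t :: real and x y
  assume "0 < t" "t < 1"
  then show "exp_sum F c u ((1 - t) *\<^sub>R x + t *\<^sub>R y)
      \<le> (1 - t) * exp_sum F c u x + t * exp_sum F c u y"
    unfolding convex_combination_exp_sum
    by (auto simp: exp_sum_def intro!: sum_mono mult_left_mono exp_inner_convex_le assms)
qed simp

text \<open>One summand with positive coefficient that tells \<open>x\<close> and \<open>y\<close>
  apart yields a strict inequality; the others contribute weak ones.\<close>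

lemma strictly_convex_on_exp_sum:
  assumes "finite F" "\<And>f. f \<in> F \<Longrightarrow> 0 \<le> c f" "convex S"
    and separating: "\<And>x y. x \<in> S \<Longrightarrow> y \<in> S \<Longrightarrow> x \<noteq> y \<Longrightarrow> \<exists>f\<in>F. 0 < c f \<and> u f \<bullet> (x - y) \<noteq> 0"
  shows "strictly_convex_on S (exp_sum F c u)"
  unfolding strictly_convex_on_def
proof (intro conjI ballI allI impI)
  fix x y and t :: real
  assume xy: "x \<in> S" "y \<in> S" and t: "x \<noteq> y \<and> 0 < t \<and> t < 1"
  obtain f where f: "f \<in> F" "0 < c f" "u f \<bullet> (x - y) \<noteq> 0"
    using separating xy t by blast
  have "exp (u f \<bullet> ((1 - t) *\<^sub>R x + t *\<^sub>R y)) < (1 - t) * exp (u f \<bullet> x) + t * exp (u f \<bullet> y)"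
    using exp_strictly_convex[of "u f \<bullet> x" "u f \<bullet> y" t] f t
    by (simp add: inner_add_right inner_diff_right)
  then show "exp_sum F c u ((1 - t) *\<^sub>R x + t *\<^sub>R y)
      < (1 - t) * exp_sum F c u x + t * exp_sum F c u y"
    unfolding convex_combination_exp_sum unfolding exp_sum_def
    using t f assms(1,2)
    by (intro sum_strict_mono_ex1)
      (auto intro!: mult_left_mono exp_inner_convex_le bexI[of _ f] mult_strict_left_mono)
qed (fact assms)

lemma exp_sum_second_derivative:
  assumes "finite F"
  obtains D where "has_second_derivative (exp_sum F c u) D x"
    and "\<And>h. blinfun_apply (blinfun_apply D h) h = (\<Sum>f\<in>F. c f * exp (u f \<bullet> x) * (u f \<bullet> h)\<^sup>2)"
proof
  define f' where "f' y = (\<Sum>f\<in>F. (c f * exp (u f \<bullet> y)) *\<^sub>R blinfun_inner_right (u f))" for y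
  \<comment> \<open>Each summand is a multiple of the rank-one form of \<open>u f\<close>: it sends
    \<open>h\<close> to the functional of \<open>u f\<close> scaled by the number
    \<open>u f \<bullet> h\<close>.\<close>
  define D where "D = (\<Sum>f\<in>F. (c f * exp (u f \<bullet> x)) *\<^sub>R
    (blinfun_scaleR_left (blinfun_inner_right (u f)) o\<^sub>L blinfun_inner_right (u f)))"
  have D: "blinfun_apply D = (\<lambda>h. \<Sum>f\<in>F. (c f * exp (u f \<bullet> x) * (u f \<bullet> h)) *\<^sub>R blinfun_inner_right (u f))"
    by (rule ext) (simp add: D_def blinfun.sum_left blinfun.scaleR_left)
  have "(exp_sum F c u has_derivative blinfun_apply (f' y)) (at y)" for y
    unfolding exp_sum_def[abs_def]
    by (auto intro!: derivative_eq_intros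
        simp: f'_def fun_eq_iff blinfun.sum_left blinfun.scaleR_left algebra_simps)
  moreover have "(f' has_derivative blinfun_apply D) (at x)"
    unfolding f'_def[abs_def] D
    by (auto intro!: derivative_eq_intros simp: fun_eq_iff algebra_simps)
  ultimately show "has_second_derivative (exp_sum F c u) D x"
    unfolding has_second_derivative_def by (intro exI[of _ f'] conjI always_eventually allI)
  show "blinfun_apply (blinfun_apply D h) h = (\<Sum>f\<in>F. c f * exp (u f \<bullet> x) * (u f \<bullet> h)\<^sup>2)" for h
    by (simp add: D blinfun.sum_left blinfun.scaleR_left power2_eq_square mult.assoc)
qed

subsection \<open>Expansion of the product\<close>

text \<open>Treating \<open>p\<close> as an extra column turns each factor of \<open>E\<close> into
  a single sum over \<open>'n option\<close>, with the same indices as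
  \<open>bordered\<close>.\<close>

definition entry :: "real ^ 'n ^ 'n \<Rightarrow> real ^ 'n \<Rightarrow> 'n \<Rightarrow> 'n option \<Rightarrow> real" where
  "entry A p i s = (case s of None \<Rightarrow> p $ i | Some j \<Rightarrow> A $ i $ j)"

text \<open>The value 0 at \<open>None\<close> is the logarithm of the factor 1 that multiplies
  \<open>p $ i\<close> in \<open>E\<close>.\<close>

definition coord :: "real ^ 'n \<Rightarrow> 'n option \<Rightarrow> real" where
  "coord x s = (case s of None \<Rightarrow> 0 | Some j \<Rightarrow> x $ j)"

definition map_coeff :: "real ^ 'n ^ 'n \<Rightarrow> real ^ 'n \<Rightarrow> ('n \<Rightarrow> 'n option) \<Rightarrow> real" where
  "map_coeff A p f = (\<Prod>i\<in>UNIV. entry A p i (f i))"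

definition exponent :: "('n::finite \<Rightarrow> 'n option) \<Rightarrow> real ^ 'n" where
  "exponent f = (\<Sum>i\<in>UNIV. (case f i of None \<Rightarrow> 0 | Some j \<Rightarrow> axis j 1) - axis i 1)"

lemma coord_simps [simp]: "coord x None = 0" "coord x (Some j) = x $ j"
  by (simp_all add: coord_def)

lemma inner_exponent: "exponent f \<bullet> x = (\<Sum>i\<in>UNIV. coord x (f i) - x $ i)"
  unfolding exponent_def inner_sum_left
  by (rule sum.cong) (auto simp: inner_diff_left inner_axis' coord_def split: option.split)

lemma g_eq_exp_sum: "g A p = exp_sum UNIV (map_coeff A p) exponent"
proof
  fix x
  have factor: "1 / exp (x $ i) * (p $ i + (\<Sum>j\<in>UNIV. A $ i $ j * exp (x $ j)))
      = (\<Sum>s\<in>UNIV. entry A p i s * exp (coord x s - x $ i))" for i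
    by (simp add: UNIV_option_conv sum.reindex entry_def exp_diff exp_minus sum_divide_distrib
        add_divide_distrib divide_inverse mult.commute)
       (simp add: sum_distrib_left mult_ac distrib_left)
  have "g A p x = (\<Prod>i\<in>UNIV. \<Sum>s\<in>UNIV. entry A p i s * exp (coord x s - x $ i))"
    by (simp add: g_def E_def vec_exp_def factor[simplified])
  also have "\<dots> = (\<Sum>f\<in>UNIV. \<Prod>i\<in>UNIV. entry A p i (f i) * exp (coord x (f i) - x $ i))"
    \<comment> \<open>Picking one summand \<open>s\<close> in every factor \<open>i\<close> amounts
      to choosing a map \<open>f\<close>.\<close>
    by (subst prod_sum_PiE) simp_all
  also have "\<dots> = exp_sum UNIV (map_coeff A p) exponent x"
    by (simp add: exp_sum_def map_coeff_def inner_exponent exp_sum prod.distrib)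
  finally show "g A p x = exp_sum UNIV (map_coeff A p) exponent x" .
qed

subsection \<open>Paths\<close>

text \<open>Induction along the path, redirecting its first index to the next vertex. The clause on
  indices off the path is carried along because it shows that the map for the tail still fixes the
  new head. \<open>None\<close> has no row in \<open>e\<close>, hence may only come last.\<close>

lemma telescoping_map:
  fixes e :: "'n::finite \<Rightarrow> 'n option \<Rightarrow> real"
  assumes "\<And>i. 0 < e i (Some i)"
    and "ss \<noteq> []" "distinct ss" "None \<notin> set (butlast ss)"
    and "\<forall>l. Suc l < length ss \<longrightarrow> (\<forall>i. ss ! l = Some i \<longrightarrow> 0 < e i (ss ! Suc l))"
  shows "\<exists>f. (\<forall>i. 0 < e i (f i)) \<and> (\<forall>i. Some i \<notin> set ss \<longrightarrow> f i = Some i) \<and>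
    (\<forall>x. exponent f \<bullet> x = coord x (last ss) - coord x (hd ss))"
  using assms(2-)
proof (induction ss rule: list_nonempty_induct)
  case (single s)
  show ?case
    using assms(1) by (intro exI[of _ Some]) (auto simp: inner_exponent)
next
  case (cons s ss)
  \<comment> \<open>A further vertex follows \<open>s\<close>, so \<open>s\<close> lies in the
    \<open>butlast\<close> and is not \<open>None\<close>.\<close>
  obtain i where s: "s = Some i"
    using cons.prems(2) cons.hyps by (cases s) auto
  have "0 < e i (hd ss)"
    using cons.prems(3)[rule_format, of 0 i] cons.hyps s by (cases ss) auto
  moreover have "\<forall>l. Suc l < length ss \<longrightarrow> (\<forall>j. ss ! l = Some j \<longrightarrow> 0 < e j (ss ! Suc l))"
    using cons.prems(3) by (metis Suc_less_eq length_Cons nth_Cons_Suc)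
  then obtain f where f: "\<forall>i. 0 < e i (f i)" "\<forall>i. Some i \<notin> set ss \<longrightarrow> f i = Some i"
    "\<forall>x. exponent f \<bullet> x = coord x (last ss) - coord x (hd ss)"
    using cons.IH cons.prems cons.hyps by auto
  \<comment> \<open>By distinctness \<open>Some i\<close> is off the tail, so the term of
    \<open>i\<close> in \<open>exponent f\<close> is 0 and redirecting \<open>i\<close> adds exactly
    the new increment.\<close>
  moreover have "f i = Some i"
    using f(2) cons.prems(1) s by auto
  then have "exponent (f(i := hd ss)) \<bullet> x = exponent f \<bullet> x + (coord x (hd ss) - x $ i)" for x
    by (simp add: inner_exponent sum.remove[of UNIV i])
  ultimately show ?case
    using s cons.hyps by (intro exI[of _ "f(i := hd ss)"] conjI) (simp_all del: fun_upd_apply, simp_all)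
qed

lemma irreducible_imp_connecting:
  fixes A :: "real ^ 'n ^ 'n"
  assumes diag: "\<And>i. 0 < A $ i $ i" and irr: "irreducible_matrix A"
  shows "\<exists>f. (\<forall>i. 0 < entry A p i (f i)) \<and> (\<forall>x. exponent f \<bullet> x = x $ s - x $ r)"
proof -
  obtain rs where rs: "rs \<noteq> []" "distinct rs" "hd rs = r" "last rs = s"
    "\<forall>l. Suc l < length rs \<longrightarrow> 0 < A $ (rs ! l) $ (rs ! Suc l)"
  proof (cases "r = s")
    \<comment> \<open>Irreducibility says nothing about \<open>r = s\<close>; the one-vertex path
      gives the zero functional.\<close>
    case True
    then show ?thesis using that[of "[r]"] by simp
  next
    case False
    then show ?thesis using irr that unfolding irreducible_matrix_def by blast
  qed
  have "\<exists>f. (\<forall>i. 0 < entry A p i (f i)) \<and> (\<forall>i. Some i \<notin> set (map Some rs) \<longrightarrow> f i = Some i) \<and>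
    (\<forall>x. exponent f \<bullet> x = coord x (last (map Some rs)) - coord x (hd (map Some rs)))"
    using diag rs
    by (intro telescoping_map) (auto simp: entry_def distinct_map map_butlast[symmetric])
  then show ?thesis
    using rs by (auto simp: hd_map last_map)
qed

text \<open>A path from \<open>Some r\<close> to \<open>None\<close> telescopes to
  \<open>- x $ r\<close>, since the coordinate at \<open>None\<close> is 0.\<close>

lemma bordered_irreducible_imp_connecting:
  fixes A :: "real ^ 'n ^ 'n"
  assumes diag: "\<And>i. 0 < A $ i $ i" and irr: "irreducible_matrix (bordered A p)"
  shows "\<exists>f. (\<forall>i. 0 < entry A p i (f i)) \<and> (\<forall>x. exponent f \<bullet> x = - x $ r)"
proof -
  obtain ss where ss: "ss \<noteq> []" "distinct ss" "hd ss = Some r" "last ss = None"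
    "\<forall>l. Suc l < length ss \<longrightarrow> 0 < bordered A p $ (ss ! l) $ (ss ! Suc l)"
    using irr unfolding irreducible_matrix_def by (metis option.distinct(1))
  \<comment> \<open>\<open>None\<close> is last and occurs once, so every step starts at some
    \<open>Some i\<close>, where \<open>bordered A p\<close> and \<open>entry A p i\<close>
    agree.\<close>
  have "None \<notin> set (butlast ss)"
    using ss(1,2,4) by (metis append_butlast_last_id distinct_butlast not_distinct_conv_prefix)
  then have "\<exists>f. (\<forall>i. 0 < entry A p i (f i)) \<and> (\<forall>i. Some i \<notin> set ss \<longrightarrow> f i = Some i) \<and>
    (\<forall>x. exponent f \<bullet> x = coord x (last ss) - coord x (hd ss))"
    using diag ss
    by (intro telescoping_map) (auto simp: entry_def bordered_def)
  then show ?thesis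
    using ss by auto
qed

text \<open>If all functionals vanished at \<open>h\<close>, the first family would make
  \<open>h\<close> constant, hence zero because its coordinates sum to 0; the second would kill each
  coordinate.\<close>

lemma connecting_separates:
  fixes h :: "real ^ 'n"
  assumes conn: "(\<forall>r s. \<exists>f. P f \<and> (\<forall>x. exponent f \<bullet> x = x $ s - x $ r)) \<or>
      (\<forall>r. \<exists>f. P f \<and> (\<forall>x. exponent f \<bullet> x = - x $ r))"
    and h: "h \<in> V 0" "h \<noteq> 0"
  shows "\<exists>f. P f \<and> exponent f \<bullet> h \<noteq> 0"
proof (rule ccontr)
  assume "\<not> ?thesis"
  then have zero: "exponent f \<bullet> h = 0" if "P f" for f
    using that by blast
  obtain k where k: "h $ k \<noteq> 0"
    using h(2) by (auto simp: vec_eq_iff)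
  from conn show False
  proof
    assume conn: "\<forall>r s. \<exists>f. P f \<and> (\<forall>x. exponent f \<bullet> x = x $ s - x $ r)"
    have "h $ s = h $ k" for s
      using conn[rule_format, of s k] zero by force
    then have "(\<Sum>i\<in>UNIV. h $ i) = (\<Sum>i\<in>(UNIV :: 'n set). h $ k)"
      by (intro sum.cong) auto
    then show False
      using h(1) k by (simp add: V_def)
  next
    assume "\<forall>r. \<exists>f. P f \<and> (\<forall>x. exponent f \<bullet> x = - x $ r)"
    then show False
      using zero k by (metis neg_equal_0_iff_equal)
  qed
qed

subsection \<open>Lower bound\<close>

lemma infnorm_attained_cart: "\<exists>k. infnorm (x :: real ^ 'n) = \<bar>x $ k\<bar>"
proof -
  have "infnorm x \<in> (\<lambda>b. \<bar>x \<bullet> b\<bar>) ` Basis"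
    unfolding infnorm_Max by (rule Max_in) auto
  then show ?thesis
    by (auto simp: Basis_vec_def inner_axis)
qed

text \<open>Let \<open>x $ k\<close> have the largest absolute value. The \<open>n - 1\<close> other
  coordinates sum to \<open>\<gamma> - x $ k\<close>, so their mean
  \<open>(\<gamma> - x $ k) / (n - 1)\<close> lies between the least and the greatest coordinate of
  \<open>x\<close>. This is the source of the constant \<open>c\<close> in the theorem.\<close>

lemma connecting_exponent_bound:
  fixes x :: "real ^ 'n"
  assumes n: "CARD('n) \<ge> 2" and x: "x \<in> V \<gamma>"
    and conn: "(\<forall>r s. \<exists>f. P f \<and> (\<forall>x. exponent f \<bullet> x = x $ s - x $ r)) \<or>
      (\<forall>r. \<exists>f. P f \<and> (\<forall>x. exponent f \<bullet> x = - x $ r))"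
  shows "\<exists>f. P f \<and> (infnorm x - \<bar>\<gamma>\<bar>) / (real CARD('n) - 1) \<le> exponent f \<bullet> x"
proof -
  define N where "N = real CARD('n) - 1"
  have N: "1 \<le> N"
    using n by (simp add: N_def)
  obtain k where k: "infnorm x = \<bar>x $ k\<bar>"
    using infnorm_attained_cart by blast
  have scale: "(infnorm x - \<bar>\<gamma>\<bar>) / N \<le> v" if "infnorm x - \<bar>\<gamma>\<bar> \<le> N * v" for v
    using that N by (simp add: divide_le_eq mult.commute)
  have rest: "(\<Sum>i\<in>UNIV - {k}. x $ i) = \<gamma> - x $ k"
    using x by (simp add: V_def sum_diff1)
  have card: "real (card (UNIV - {k})) = N"
    using n by (simp add: N_def of_nat_diff)
  obtain lo where lo: "\<And>i. x $ lo \<le> x $ i"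
    using arg_min_least[of UNIV _ "($) x"] by (meson UNIV_I UNIV_not_empty finite)
  obtain hi where hi: "\<And>i. x $ i \<le> x $ hi"
    using arg_min_least[of UNIV _ "\<lambda>i. - x $ i"] by (meson UNIV_I UNIV_not_empty finite neg_le_iff_le)
  have low: "N * x $ lo \<le> \<gamma> - x $ k"
    using sum_bounded_below[of "UNIV - {k}" "x $ lo" "($) x"] lo rest card by simp
  have high: "\<gamma> - x $ k \<le> N * x $ hi"
    using sum_bounded_above[of "UNIV - {k}" "($) x" "x $ hi"] hi rest card by simp
  \<comment> \<open>Since \<open>1 \<le> N\<close>, a nonnegative bound without the factor
    \<open>N\<close> can be weakened to one with it.\<close>
  have grow: "v \<le> N * v" if "0 \<le> v" for v
    using mult_right_mono[OF N that] by simp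
  show ?thesis
    using conn
  proof
    assume conn: "\<forall>r s. \<exists>f. P f \<and> (\<forall>x. exponent f \<bullet> x = x $ s - x $ r)"
    \<comment> \<open>If \<open>x $ k\<close> is nonnegative, \<open>low\<close> provides the bound
      and \<open>x $ hi\<close> only helps; otherwise \<open>high\<close> provides it and
      \<open>- x $ lo\<close> only helps.\<close>
    have "infnorm x - \<bar>\<gamma>\<bar> \<le> N * (x $ hi - x $ lo)"
    proof (cases "0 \<le> x $ k")
      case True
      then show ?thesis
        using grow[of "x $ hi"] hi[of k] low k by (simp add: right_diff_distrib)
    next
      case False
      then show ?thesis
        using grow[of "- x $ lo"] lo[of k] high k by (smt (verit) minus_mult_right right_diff_distrib)
    qed
    then show ?thesis
      using conn[rule_format, of hi lo] scale unfolding N_def by metis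
  next
    assume conn: "\<forall>r. \<exists>f. P f \<and> (\<forall>x. exponent f \<bullet> x = - x $ r)"
    \<comment> \<open>For \<open>x $ k \<ge> 0\<close> the mean gives the bound; otherwise
      \<open>- x $ lo \<ge> - x $ k = infnorm x\<close> directly.\<close>
    have "infnorm x - \<bar>\<gamma>\<bar> \<le> N * (- x $ lo)"
    proof (cases "0 \<le> x $ k")
      case True
      then show ?thesis
        using low k by simp
    next
      case False
      then show ?thesis
        using grow[of "- x $ lo"] lo[of k] k by linarith
    qed
    then show ?thesis
      using conn[rule_format, of lo] scale unfolding N_def by metis
  qed
qed

text \<open>The positive entry makes the set under \<open>Min\<close> nonempty, so the minimum is
  one of its members: nonzero and, as all entries are nonnegative, positive.\<close>

lemma smallest_nonzero_entry_bounds: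
  fixes A :: "real ^ 'n ^ 'n"
  assumes nonneg: "\<And>i j. 0 \<le> A $ i $ j" "\<And>i. 0 \<le> p $ i" and pos: "0 < entry A p i s"
  shows "0 < smallest_nonzero_entry A p" "smallest_nonzero_entry A p \<le> entry A p i s"
proof -
  define S where "S = (range (\<lambda>(i, j). A $ i $ j) \<union> range (\<lambda>i. p $ i)) - {0}"
  have "entry A p i s \<in> range (\<lambda>(i, j). A $ i $ j) \<union> range (\<lambda>i. p $ i)"
    unfolding entry_def by (cases s) (auto intro: image_eqI[of _ _ "(i, j)" for j])
  then have mem: "entry A p i s \<in> S"
    using pos by (simp add: S_def)
  have fin: "finite S"
    by (simp add: S_def)
  show "smallest_nonzero_entry A p \<le> entry A p i s"
    unfolding smallest_nonzero_entry_def S_def[symmetric] using mem fin by simp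
  have "Min S \<in> S"
    using mem fin by (intro Min_in) auto
  moreover have "0 \<le> v" if "v \<in> S" for v
    using that nonneg by (auto simp: S_def)
  ultimately show "0 < smallest_nonzero_entry A p"
    unfolding smallest_nonzero_entry_def S_def[symmetric]
    by (force simp: S_def order.strict_iff_order)
qed

section \<open>Convexity, second derivative and lower bound of \<open>g\<close> from its
  expansion\<close>

theorem theoremV1:
  fixes A :: "real ^ 'n ^ 'n" and p :: "real ^ 'n" and \<gamma> :: real
  assumes "CARD('n) \<ge> 2"
    and "\<And>i j. A $ i $ j \<ge> 0"
    and "\<And>i. p $ i \<ge> 0"
  shows "convex_on UNIV (g A p) \<and>
    ((\<forall>i. A $ i $ i > 0) \<and> (irreducible_matrix A \<or> irreducible_matrix (bordered A p)) \<longrightarrow>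
      (strictly_convex_on (V \<gamma>) (g A p) \<and>
       (\<forall>x\<in>V \<gamma>. \<exists>D. has_second_derivative (g A p) D x \<and>
          (\<forall>h\<in>V 0 - {0}. blinfun_apply (blinfun_apply D h) h > 0))) \<and>
      (let \<mu> = smallest_nonzero_entry A p; c = 1 / (real CARD('n) - 1) in
        \<forall>x\<in>V \<gamma>. g A p x \<ge> \<mu> ^ CARD('n) * exp (- \<bar>\<gamma>\<bar> * c) * exp (c * infnorm x)))"
proof -
  have coeff_nonneg: "0 \<le> map_coeff A p f" for f
    using assms(2,3) by (auto simp: map_coeff_def entry_def intro!: prod_nonneg split: option.split)
  have "convex_on UNIV (g A p)"
    unfolding g_eq_exp_sum by (intro convex_on_exp_sum coeff_nonneg)
  moreover have "strictly_convex_on (V \<gamma>) (g A p)"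
    and "\<forall>x\<in>V \<gamma>. \<exists>D. has_second_derivative (g A p) D x \<and>
          (\<forall>h\<in>V 0 - {0}. blinfun_apply (blinfun_apply D h) h > 0)"
    and "\<forall>x\<in>V \<gamma>. smallest_nonzero_entry A p ^ CARD('n) * exp (- \<bar>\<gamma>\<bar> * (1 / (real CARD('n) - 1)))
          * exp (1 / (real CARD('n) - 1) * infnorm x) \<le> g A p x"
    if diag: "\<forall>i. A $ i $ i > 0" and irr: "irreducible_matrix A \<or> irreducible_matrix (bordered A p)"
  proof -
    \<comment> \<open>Positivity is kept entrywise: this makes the coefficient positive and also
      lets each chosen entry be compared with \<open>\<mu>\<close>.\<close>
    define P where "P f \<longleftrightarrow> (\<forall>i. 0 < entry A p i (f i))" for f
    have conn: "(\<forall>r s. \<exists>f. P f \<and> (\<forall>x. exponent f \<bullet> x = x $ s - x $ r)) \<or>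
      (\<forall>r. \<exists>f. P f \<and> (\<forall>x. exponent f \<bullet> x = - x $ r))"
      using irr irreducible_imp_connecting bordered_irreducible_imp_connecting diag
      unfolding P_def by meson
    have coeff_pos: "0 < map_coeff A p f" if "P f" for f
      using that by (auto simp: map_coeff_def P_def intro!: prod_pos)
    have sep: "\<exists>f\<in>UNIV. 0 < map_coeff A p f \<and> exponent f \<bullet> h \<noteq> 0" if "h \<in> V 0" "h \<noteq> 0" for h
      using connecting_separates[OF conn that] coeff_pos by blast
    show "strictly_convex_on (V \<gamma>) (g A p)"
      unfolding g_eq_exp_sum
    proof (rule strictly_convex_on_exp_sum)
      show "convex (V \<gamma> :: (real ^ 'n) set)"
        unfolding convex_def
        by (auto simp: V_def sum.distrib sum_distrib_left[symmetric] distrib_right[symmetric])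
      fix x y :: "real ^ 'n"
      assume "x \<in> V \<gamma>" "y \<in> V \<gamma>" "x \<noteq> y"
      \<comment> \<open>Two points of \<open>V \<gamma>\<close> differ by an element of
        \<open>V 0\<close>.\<close>
      then show "\<exists>f\<in>UNIV. 0 < map_coeff A p f \<and> exponent f \<bullet> (x - y) \<noteq> 0"
        by (intro sep) (auto simp: V_def sum_subtractf)
    qed (auto intro: coeff_nonneg)
    show "\<forall>x\<in>V \<gamma>. \<exists>D. has_second_derivative (g A p) D x \<and>
          (\<forall>h\<in>V 0 - {0}. blinfun_apply (blinfun_apply D h) h > 0)"
    proof
      fix x :: "real ^ 'n"
      obtain D where D: "has_second_derivative (g A p) D x"
        "\<And>h. blinfun_apply (blinfun_apply D h) h
          = (\<Sum>f\<in>UNIV. map_coeff A p f * exp (exponent f \<bullet> x) * (exponent f \<bullet> h)\<^sup>2)"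
        using exp_sum_second_derivative[of UNIV "map_coeff A p" exponent x]
        unfolding g_eq_exp_sum by auto
      have "blinfun_apply (blinfun_apply D h) h > 0" if h: "h \<in> V 0 - {0}" for h
      proof -
        obtain f where "0 < map_coeff A p f" "exponent f \<bullet> h \<noteq> 0"
          using sep h by blast
        then show ?thesis
          unfolding D(2) by (intro sum_pos2[of _ f]) (auto intro!: mult_nonneg_nonneg coeff_nonneg)
      qed
      with D(1) show "\<exists>D. has_second_derivative (g A p) D x \<and>
          (\<forall>h\<in>V 0 - {0}. blinfun_apply (blinfun_apply D h) h > 0)"
        by blast
    qed
    show "\<forall>x\<in>V \<gamma>. smallest_nonzero_entry A p ^ CARD('n) * exp (- \<bar>\<gamma>\<bar> * (1 / (real CARD('n) - 1)))
          * exp (1 / (real CARD('n) - 1) * infnorm x) \<le> g A p x"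
    proof
      fix x :: "real ^ 'n"
      assume "x \<in> V \<gamma>"
      then obtain f where f: "P f" "(infnorm x - \<bar>\<gamma>\<bar>) / (real CARD('n) - 1) \<le> exponent f \<bullet> x"
        using connecting_exponent_bound[OF assms(1) _ conn] by blast
      have entries: "0 < smallest_nonzero_entry A p" "smallest_nonzero_entry A p \<le> entry A p i (f i)" for i
        using smallest_nonzero_entry_bounds[of A p i "f i"] assms(2,3) f(1) by (auto simp: P_def)
      \<comment> \<open>\<open>f\<close> selects one entry from each of the \<open>n\<close> rows,
        all at least \<open>\<mu>\<close>.\<close>
      have "(\<Prod>i\<in>(UNIV :: 'n set). smallest_nonzero_entry A p) \<le> map_coeff A p f"
        unfolding map_coeff_def using entries by (intro prod_mono) (auto intro: less_imp_le)
      then have "smallest_nonzero_entry A p ^ CARD('n) * exp ((infnorm x - \<bar>\<gamma>\<bar>) / (real CARD('n) - 1))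
          \<le> map_coeff A p f * exp (exponent f \<bullet> x)"
        using f(2) coeff_nonneg by (intro mult_mono) auto
      also have "\<dots> \<le> g A p x"
        unfolding g_eq_exp_sum exp_sum_def
        by (rule member_le_sum[of f UNIV "\<lambda>f. map_coeff A p f * exp (exponent f \<bullet> x)"])
          (auto intro!: mult_nonneg_nonneg coeff_nonneg)
      finally show "smallest_nonzero_entry A p ^ CARD('n) * exp (- \<bar>\<gamma>\<bar> * (1 / (real CARD('n) - 1)))
          * exp (1 / (real CARD('n) - 1) * infnorm x) \<le> g A p x"
        by (simp add: mult.assoc exp_add[symmetric] diff_divide_distrib)
    qed
  qed
  ultimately show ?thesis
    unfolding Let_def by blast
qed

end
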